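(* For any natural numbers $k,n$ with $2\le k\le n$, there exist both (i) a full isothermic discrete $k$-dimensional torus in $\mathbb{R}^n$ and (ii) a full isothermic semi-discrete $k$-dimensional torus in $\mathbb{R}^n$.
   Context: **Circles and cross ratio.** "Concircular" means lying on a common circle of $\mathbb{R}^n$ in the sense of Möbius geometry (straight lines count as circles). For $y\in\mathbb{R}^n$ let $Y=(2y,\,1-|y|^2,\,1+|y|^2)\in\mathbb{R}^{n+1,1}$ be its lift to the light cone, where $\mathbb{R}^{n+1,1}$ has the inner product $\langle\cdot,\cdot\rangle$ of signature $(+,\dots,+,-)$. For points $y,y_1,y_{12},y_2\in\mathbb{R}^n$ with lifts $Y,Y_1,Y_{12},Y_2$, put $$\mathrm{cr}(y,y_1,y_{12},y_2)=\frac{\langle Y,Y_1\rangle\langle Y_{12},Y_2\rangle+\langle Y,Y_2\rangle\langle Y_1,Y_{12}\rangle-\langle Y,Y_{12}\rangle\langle Y_1,Y_2\rangle}{2\langle Y,Y_2\rangle\langle Y_1,Y_{12}\rangle}.$$ For concircular points this is their (real) cross ratio. (Note $\langle Y,Z\rangle=-2|y-z|^2$ for lifts $Y,Z$ of $y,z$.) **Infinitesimal cross ratio.** Two smooth regular curves $y(t),z(t)$ in $\mathbb{R}^n$ with $y(t)\neq z(t)$ for all $t$ have a common circle congruence if for each $t$ there is a circle tangent to the curve $y$ at $y(t)$ and to the curve $z$ at $z(t)$. In that case their infinitesimal cross ratio is $$\lim_{\Delta t\to0}(\Delta t)^{-2}\,\mathrm{cr}\big(y(t),y(t+\Delta t),z(t+\Delta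 t),z(t)\big).$$ **Nets.** A *discrete $k$-dimensional net* is a map $f:\mathbb{Z}^k\to\mathbb{R}^n$. A *semi-discrete $k$-dimensional net* is a map $f:\mathbb{R}\times\mathbb{Z}^{k-1}\to\mathbb{R}^n$, smooth in the first (smooth) variable with nowhere vanishing derivative in it; the other $k-1$ variables are discrete. A 2-dimensional coordinate subnet is obtained by fixing all but two of the coordinates. **Orthogonal (curvature line) nets.** Such a net is a discretized orthogonal net (curvature line system) if every 2-dimensional coordinate subnet satisfies the following. - If both of its variable coordinates $x_i,x_j$ are discrete: each elementary quadrilateral $f,\ f_i,\ f_{ij},\ f_j$ (the values at a lattice point and at its shifts by one in $x_i$, in both $x_i$ and $x_j$, and in $x_j$, respectively) has four distinct concircular vertices. - If $x_i$ is smooth and $x_j$ is discrete: any two adjacent smooth curves (parametrized by the smooth variable $x_i$, for consecutive values of $x_j$) have distinct corresponding points and a common circle congruence. **Isothermic nets.** A discretized orthogonal net is *isothermic* if, in addition, every 2-dimensional coordinate subnet with variable coordinates $(x_i,x_j)$ satisfies the following. - If $x_i,x_j$ are both discrete: the cross ratios $\mathrm{cr}(f,f_i,f_{ij},f_j)$ of the elementary quadrilaterals, regarded as a function on the faces (labelled by the coordinates $(x_i,x_j)$ of the lower left vertex), have the form $a(x_i)/b(x_j)$, where $a$ depends only on $x_i$ and $b$ depends only on $x_j$. (Equivalently, for the four quadrilaterals ordered counterclockwise around any vertex, $\mathrm{cr}_1\,\mathrm{cr}_2^{-1}\,\mathrm{cr}_3\,\mathrm{cr}_4^{-1}=1$.)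 - If $x_i$ is smooth and $x_j$ is discrete: the infinitesimal cross ratios of adjacent smooth curves (the curve at $x_j$ taken as $y$ and the curve at $x_j+1$ taken as $z$) have the form $a(x_i)/b(x_j)$, where $a$ is a function of the smooth variable only and $b$ is a function of $x_j$ only. **Tori.** A (semi-)discrete $k$-dimensional torus is a (semi-)discrete $k$-dimensional net that is periodic in each of its $k$ coordinates: it is invariant under translation of each discrete coordinate by some integer period $\ell\ge3$ (depending on the coordinate) and, in the semi-discrete case, under translation of the smooth coordinate by some positive real period. It is called isothermic if the net is isothermic. **Full.** A net (or torus) in $\mathbb{R}^n$ is *full* if its image does not lie in any $(n-1)$-dimensional affine subspace of $\mathbb{R}^n$. *)

theory Defs
  imports "HOL-Analysis.Analysis"
begin

type_synonym 'n lorentz = "(real ^ 'n) \<times> real \<times> real"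

definition lorentz_inner :: "'n::finite lorentz \<Rightarrow> 'n lorentz \<Rightarrow> real" where
  "lorentz_inner V W =
     fst V \<bullet> fst W + fst (snd V) * fst (snd W) - snd (snd V) * snd (snd W)"

definition lift :: "real ^ 'n::finite \<Rightarrow> 'n lorentz" where
  "lift y = (2 *\<^sub>R y, 1 - (norm y)\<^sup>2, 1 + (norm y)\<^sup>2)"

lemma lorentz_inner_lift: "lorentz_inner (lift y) (lift z) = - 2 * (norm (y - z))\<^sup>2"
  by (simp add: lorentz_inner_def lift_def power2_norm_eq_inner inner_diff inner_commute
      algebra_simps)

definition cr :: "real ^ 'n::finite \<Rightarrow> real ^ 'n \<Rightarrow> real ^ 'n \<Rightarrow> real ^ 'n \<Rightarrow> real" where
  "cr y y1 y12 y2 =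
     (let Y = lift y; Y1 = lift y1; Y12 = lift y12; Y2 = lift y2 in
      (lorentz_inner Y Y1 * lorentz_inner Y12 Y2 + lorentz_inner Y Y2 * lorentz_inner Y1 Y12
         - lorentz_inner Y Y12 * lorentz_inner Y1 Y2)
      / (2 * lorentz_inner Y Y2 * lorentz_inner Y1 Y12))"

definition straight_line :: "(real ^ 'n::finite) set \<Rightarrow> bool" where
  "straight_line C \<longleftrightarrow> affine C \<and> aff_dim C = 1"

definition round_circle ::
  "(real ^ 'n::finite) set \<Rightarrow> real ^ 'n \<Rightarrow> real \<Rightarrow> (real ^ 'n) set \<Rightarrow> bool" where
  "round_circle P c r C \<longleftrightarrow>
     affine P \<and> aff_dim P = 2 \<and> c \<in> P \<and> r > 0 \<and> C = P \<inter> sphere c r"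

definition moebius_circle :: "(real ^ 'n::finite) set \<Rightarrow> bool" where
  "moebius_circle C \<longleftrightarrow> straight_line C \<or> (\<exists>P c r. round_circle P c r C)"

definition concircular :: "(real ^ 'n::finite) set \<Rightarrow> bool" where
  "concircular S \<longleftrightarrow> (\<exists>C. moebius_circle C \<and> S \<subseteq> C)"

text \<open>The vector \<open>v\<close> is tangent to \<open>C\<close> at \<open>p\<close>: for a line, \<open>v\<close> is a direction vector;
  for a round circle, \<open>v\<close> is parallel to its plane and orthogonal to the radius.\<close>

definition tangent_to_circle ::
  "(real ^ 'n::finite) set \<Rightarrow> real ^ 'n \<Rightarrow> real ^ 'n \<Rightarrow> bool" where
  "tangent_to_circle C p v \<longleftrightarrow> p \<in> C \<and>
     (straight_line C \<and> p + v \<in> C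
      \<or> (\<exists>P c r. round_circle P c r C \<and> p + v \<in> P \<and> v \<bullet> (p - c) = 0))"

abbreviation velocity :: "(real \<Rightarrow> 'a::real_normed_vector) \<Rightarrow> real \<Rightarrow> 'a" where
  "velocity c t \<equiv> vector_derivative c (at t)"

definition smooth_curve :: "(real \<Rightarrow> 'a::real_normed_vector) \<Rightarrow> bool" where
  "smooth_curve c \<longleftrightarrow> (\<forall>m t. (velocity ^^ m) c differentiable (at t))"

definition regular_curve :: "(real \<Rightarrow> 'a::real_normed_vector) \<Rightarrow> bool" where
  "regular_curve c \<longleftrightarrow> (\<forall>t. velocity c t \<noteq> 0)"

definition common_circle_congruence ::
  "(real \<Rightarrow> real ^ 'n::finite) \<Rightarrow> (real \<Rightarrow> real ^ 'n) \<Rightarrow> bool" where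
  "common_circle_congruence y z \<longleftrightarrow>
     (\<forall>t. \<exists>C. moebius_circle C \<and>
        tangent_to_circle C (y t) (velocity y t) \<and> tangent_to_circle C (z t) (velocity z t))"

definition has_infinitesimal_cr ::
  "(real \<Rightarrow> real ^ 'n::finite) \<Rightarrow> (real \<Rightarrow> real ^ 'n) \<Rightarrow> real \<Rightarrow> real \<Rightarrow> bool" where
  "has_infinitesimal_cr y z t q \<longleftrightarrow>
     ((\<lambda>h. cr (y t) (y (t + h)) (z (t + h)) (z t) / h\<^sup>2) \<longlongrightarrow> q) (at 0)"

text \<open>Conditions on two-dimensional nets, with two discrete variables and with one smooth
  and one discrete variable, respectively.\<close>

definition circular_dd :: "(int \<Rightarrow> int \<Rightarrow> real ^ 'n::finite) \<Rightarrow> bool" where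
  "circular_dd g \<longleftrightarrow>
     (\<forall>s t. distinct [g s t, g (s + 1) t, g (s + 1) (t + 1), g s (t + 1)] \<and>
            concircular {g s t, g (s + 1) t, g (s + 1) (t + 1), g s (t + 1)})"

definition circular_sd :: "(real \<Rightarrow> int \<Rightarrow> real ^ 'n::finite) \<Rightarrow> bool" where
  "circular_sd g \<longleftrightarrow>
     (\<forall>m. (\<forall>t. g t m \<noteq> g t (m + 1)) \<and>
          common_circle_congruence (\<lambda>t. g t m) (\<lambda>t. g t (m + 1)))"

definition isothermic_dd :: "(int \<Rightarrow> int \<Rightarrow> real ^ 'n::finite) \<Rightarrow> bool" where
  "isothermic_dd g \<longleftrightarrow>
     (\<exists>a b :: int \<Rightarrow> real. (\<forall>t. b t \<noteq> 0) \<and>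
        (\<forall>s t. cr (g s t) (g (s + 1) t) (g (s + 1) (t + 1)) (g s (t + 1)) = a s / b t))"

definition isothermic_sd :: "(real \<Rightarrow> int \<Rightarrow> real ^ 'n::finite) \<Rightarrow> bool" where
  "isothermic_sd g \<longleftrightarrow>
     (\<exists>(a :: real \<Rightarrow> real) (b :: int \<Rightarrow> real). (\<forall>m. b m \<noteq> 0) \<and>
        (\<forall>t m. has_infinitesimal_cr (\<lambda>s. g s m) (\<lambda>s. g s (m + 1)) t (a t / b m)))"

text \<open>A discrete \<open>k\<close>-dimensional net is a map on \<open>int_lattice k\<close>; its values elsewhere are
  irrelevant. A semi-discrete \<open>k\<close>-dimensional net takes the smooth variable and a point of
  \<open>int_lattice (k - 1)\<close>.\<close>

definition int_lattice :: "nat \<Rightarrow> (nat \<Rightarrow> int) set" where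
  "int_lattice k = {..<k} \<rightarrow>\<^sub>E UNIV"

definition discrete_orthogonal :: "nat \<Rightarrow> ((nat \<Rightarrow> int) \<Rightarrow> real ^ 'n::finite) \<Rightarrow> bool" where
  "discrete_orthogonal k f \<longleftrightarrow>
     (\<forall>x \<in> int_lattice k. \<forall>i < k. \<forall>j < k. i \<noteq> j \<longrightarrow>
        circular_dd (\<lambda>s t. f (x(i := s, j := t))))"

definition discrete_isothermic :: "nat \<Rightarrow> ((nat \<Rightarrow> int) \<Rightarrow> real ^ 'n::finite) \<Rightarrow> bool" where
  "discrete_isothermic k f \<longleftrightarrow> discrete_orthogonal k f \<and>
     (\<forall>x \<in> int_lattice k. \<forall>i < k. \<forall>j < k. i \<noteq> j \<longrightarrow>
        isothermic_dd (\<lambda>s t. f (x(i := s, j := t))))"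

definition discrete_torus :: "nat \<Rightarrow> ((nat \<Rightarrow> int) \<Rightarrow> real ^ 'n::finite) \<Rightarrow> bool" where
  "discrete_torus k f \<longleftrightarrow>
     (\<forall>i < k. \<exists>l \<ge> 3. \<forall>x \<in> int_lattice k. f (x(i := x i + l)) = f x)"

definition semi_discrete_net ::
  "nat \<Rightarrow> (real \<Rightarrow> (nat \<Rightarrow> int) \<Rightarrow> real ^ 'n::finite) \<Rightarrow> bool" where
  "semi_discrete_net k f \<longleftrightarrow>
     (\<forall>x \<in> int_lattice (k - 1). smooth_curve (\<lambda>t. f t x) \<and> regular_curve (\<lambda>t. f t x))"

definition semi_discrete_orthogonal ::
  "nat \<Rightarrow> (real \<Rightarrow> (nat \<Rightarrow> int) \<Rightarrow> real ^ 'n::finite) \<Rightarrow> bool" where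
  "semi_discrete_orthogonal k f \<longleftrightarrow> semi_discrete_net k f \<and>
     (\<forall>t. discrete_orthogonal (k - 1) (f t)) \<and>
     (\<forall>x \<in> int_lattice (k - 1). \<forall>j < k - 1. circular_sd (\<lambda>t m. f t (x(j := m))))"

definition semi_discrete_isothermic ::
  "nat \<Rightarrow> (real \<Rightarrow> (nat \<Rightarrow> int) \<Rightarrow> real ^ 'n::finite) \<Rightarrow> bool" where
  "semi_discrete_isothermic k f \<longleftrightarrow> semi_discrete_orthogonal k f \<and>
     (\<forall>t. discrete_isothermic (k - 1) (f t)) \<and>
     (\<forall>x \<in> int_lattice (k - 1). \<forall>j < k - 1. isothermic_sd (\<lambda>t m. f t (x(j := m))))"

definition semi_discrete_torus ::
  "nat \<Rightarrow> (real \<Rightarrow> (nat \<Rightarrow> int) \<Rightarrow> real ^ 'n::finite) \<Rightarrow> bool" where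
  "semi_discrete_torus k f \<longleftrightarrow> semi_discrete_net k f \<and>
     (\<exists>p > 0. \<forall>t. \<forall>x \<in> int_lattice (k - 1). f (t + p) x = f t x) \<and>
     (\<forall>i < k - 1. \<exists>l \<ge> 3. \<forall>t. \<forall>x \<in> int_lattice (k - 1). f t (x(i := x i + l)) = f t x)"

definition full :: "(real ^ 'n::finite) set \<Rightarrow> bool" where
  "full S \<longleftrightarrow> \<not> (\<exists>A. affine A \<and> aff_dim A = int CARD('n) - 1 \<and> S \<subseteq> A)"

end

theory Submission
  imports Defs
begin

text \<open>
  A rectangle with side vectors \<open>a\<close>, \<open>b\<close> is inscribed in a circle, and its cross ratio is
  \<open>- |a|\<^sup>2 / |b|\<^sup>2\<close>. Hence a net that is a sum of discrete curves lying in pairwise orthogonal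
  subspaces, one curve for each variable, is isothermic: all its elementary quadrilaterals are
  rectangles, and each side length depends on one variable only
  (\<open>product_net_isothermic\<close>). It is a torus as soon as each of the curves is periodic.
  A periodic discrete curve may live in a line, where it runs along a segment and jumps back to its
  start; so \<open>k\<close> dimensions already have room for \<open>k\<close> of them. If \<open>n > k\<close>, one of the curves is
  given the \<open>n - k\<close> remaining dimensions in addition and made to leave its line in each of
  these directions. The result is a full discrete torus.

  A closed regular smooth curve does not fit in a line, so in the semi-discrete case a product
  would need \<open>k + 1\<close> dimensions. Instead, a discrete product net with \<open>k - 1\<close> variables in
  the half space \<open>r > 0\<close> of \<open>\<real>\<^sup>n\<^sup>-\<^sup>1\<close>, in which the distance \<open>r\<close> to the
  axis depends on the first variable only, is rotated about that axis with angle \<open>t\<close>. For fixed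
  \<open>t\<close> this is again a product net. Two adjacent smooth curves are circles with a common axis;
  at each \<open>t\<close> their tangents are parallel to each other and orthogonal to the segment joining the
  two points, so that the circle which has this segment as a diameter and lies in the plane of the
  segment and the tangents touches both curves. If the radii are \<open>r\<close> and \<open>r'\<close> and the
  segment has length \<open>l\<close>, the infinitesimal cross ratio is \<open>- r r' / l\<^sup>2\<close>
  (\<open>infinitesimal_cr_rotating\<close>). It does not depend on \<open>t\<close>, so it has the form required of an
  isothermic net.

  Fullness is verified by showing that a linear form which is constant on the net vanishes on enough
  differences of net points to vanish on all coordinate directions.
\<close>

section \<open>Circles through rectangles\<close>

lemma affine_plane:
  fixes a b y :: "real ^ 'n::finite"
  assumes "a \<noteq> 0" "b \<noteq> 0" "a \<bullet> b = 0"
  shows "affine ((+) y ` span {a, b})" "aff_dim ((+) y ` span {a, b}) = 2"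
proof -
  show "affine ((+) y ` span {a, b})"
    using affine_translation subspace_imp_affine subspace_span by blast
  have "a \<noteq> b" using assms by auto
  have "independent {a, b}"
    by (rule pairwise_orthogonal_independent)
      (use assms in \<open>auto simp: pairwise_def orthogonal_def inner_commute\<close>)
  then have "dim (span {a, b}) = 2"
    using \<open>a \<noteq> b\<close> by (simp add: dim_eq_card_independent)
  then show "aff_dim ((+) y ` span {a, b}) = 2"
    by (simp add: aff_dim_translation_eq aff_dim_subspace)
qed

lemma plane_point:
  "y + (r *\<^sub>R a + s *\<^sub>R b) \<in> (+) y ` span {a, b}" for y :: "real ^ 'n::finite"
  by (intro imageI span_add span_scale) (auto intro: span_base)

lemma round_circle_with_diameter:
  fixes d w y :: "real ^ 'n::finite"
  assumes "d \<noteq> 0" "w \<noteq> 0" "d \<bullet> w = 0"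
  defines "P \<equiv> (+) y ` span {d, w}" and "c \<equiv> y + (1/2) *\<^sub>R d"
  shows "round_circle P c (norm d / 2) (P \<inter> sphere c (norm d / 2))"
  unfolding round_circle_def
proof (intro conjI)
  show "affine P" "aff_dim P = 2"
    using affine_plane[OF assms(1-3)] by (auto simp: P_def)
  show "c \<in> P"
    using plane_point[of y "1/2" d 0 w] by (simp add: P_def c_def)
qed (use assms in auto)

lemma rectangle_concircular:
  fixes a b y :: "real ^ 'n::finite"
  assumes "a \<noteq> 0" "b \<noteq> 0" "a \<bullet> b = 0"
  shows "concircular {y, y + a, y + a + b, y + b}"
proof -
  define P where "P = (+) y ` span {a, b}"
  define c where "c = y + (1/2) *\<^sub>R (a + b)"
  define r where "r = norm (a + b) / 2"
  have nz: "a + b \<noteq> 0"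
    using assms by (metis add_eq_0_iff inner_eq_zero_iff inner_minus_right neg_equal_0_iff_equal)
  have pts: "y \<in> P" "y + a \<in> P" "y + a + b \<in> P" "y + b \<in> P" "c \<in> P"
    using plane_point[of y 0 a 0 b] plane_point[of y 1 a 0 b] plane_point[of y 1 a 1 b]
      plane_point[of y 0 a 1 b] plane_point[of y "1/2" a "1/2" b]
    by (simp_all add: P_def c_def add.assoc scaleR_add_right)
  have r2: "norm (a - b) = norm (a + b)"
    using assms by (simp add: norm_eq_sqrt_inner inner_diff inner_add inner_commute)
  have "c - y = (1/2) *\<^sub>R (a + b)" "c - (y + a) = (-1/2) *\<^sub>R (a - b)"
    "c - (y + a + b) = (-1/2) *\<^sub>R (a + b)" "c - (y + b) = (1/2) *\<^sub>R (a - b)"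
    by (simp_all add: c_def vec_eq_iff field_simps)
  then have "{y, y + a, y + a + b, y + b} \<subseteq> P \<inter> sphere c r"
    using pts by (simp add: dist_norm r_def r2)
  moreover have "round_circle P c r (P \<inter> sphere c r)"
    using affine_plane[OF assms, of y] pts nz by (simp add: round_circle_def P_def r_def)
  ultimately show ?thesis
    unfolding concircular_def moebius_circle_def by blast
qed

text \<open>The factors \<open>-2\<close> that relate Lorentz products of lifts to squared distances cancel.\<close>

lemma cr_eq_norms:
  "cr y y1 y12 y2 =
     ((norm (y - y1))\<^sup>2 * (norm (y12 - y2))\<^sup>2 + (norm (y - y2))\<^sup>2 * (norm (y1 - y12))\<^sup>2
        - (norm (y - y12))\<^sup>2 * (norm (y1 - y2))\<^sup>2)
      / (2 * (norm (y - y2))\<^sup>2 * (norm (y1 - y12))\<^sup>2)"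
proof -
  let ?p = "(norm (y - y1))\<^sup>2 * (norm (y12 - y2))\<^sup>2 + (norm (y - y2))\<^sup>2 * (norm (y1 - y12))\<^sup>2
        - (norm (y - y12))\<^sup>2 * (norm (y1 - y2))\<^sup>2"
  let ?q = "2 * (norm (y - y2))\<^sup>2 * (norm (y1 - y12))\<^sup>2"
  have "cr y y1 y12 y2 = (4 * ?p) / (4 * ?q)"
    unfolding cr_def Let_def lorentz_inner_lift
    by (rule arg_cong2[where f = "(/)"]) (simp_all add: algebra_simps)
  also have "\<dots> = ?p / ?q"
    by (rule mult_divide_mult_cancel_left) simp
  finally show ?thesis .
qed

lemma cr_rectangle:
  fixes a b y :: "real ^ 'n::finite"
  assumes "b \<noteq> 0" "a \<bullet> b = 0"
  shows "cr y (y + a) (y + a + b) (y + b) = - (norm a)\<^sup>2 / (norm b)\<^sup>2"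
proof -
  have d: "(norm (y - (y + a + b)))\<^sup>2 = (norm a)\<^sup>2 + (norm b)\<^sup>2"
    "(norm (y + a - (y + b)))\<^sup>2 = (norm a)\<^sup>2 + (norm b)\<^sup>2"
    using assms by (simp_all add: power2_norm_eq_inner inner_diff inner_add inner_commute)
  have e: "norm (y - (y + a)) = norm a" "norm (y + a + b - (y + b)) = norm a"
    "norm (y - (y + b)) = norm b" "norm (y + a - (y + a + b)) = norm b"
    by (simp_all add: norm_minus_commute)
  have "norm b \<noteq> 0" using assms by simp
  then show ?thesis
    unfolding cr_eq_norms d e by (simp add: field_simps power2_eq_square)
qed

section \<open>Products of discrete curves\<close>

text \<open>All quadrilaterals are rectangles, and the squares of their side lengths serve, up to sign,
  as the functions \<open>a\<close> and \<open>b\<close> of the isothermic condition.\<close>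

lemma orthogonal_sum_net:
  fixes A B :: "int \<Rightarrow> real ^ 'n::finite"
  assumes orth: "\<And>s t. (A (s + 1) - A s) \<bullet> (B (t + 1) - B t) = 0"
    and A: "\<And>s. A (s + 1) \<noteq> A s" and B: "\<And>t. B (t + 1) \<noteq> B t"
  shows "circular_dd (\<lambda>s t. A s + B t)" and "isothermic_dd (\<lambda>s t. A s + B t)"
proof -
  have vertices: "A (s + 1) + B t = A s + B t + (A (s + 1) - A s)"
    "A (s + 1) + B (t + 1) = A s + B t + (A (s + 1) - A s) + (B (t + 1) - B t)"
    "A s + B (t + 1) = A s + B t + (B (t + 1) - B t)" for s t
    by simp_all
  show "circular_dd (\<lambda>s t. A s + B t)"
    unfolding circular_dd_def
  proof (intro allI conjI)
    fix s t
    have "A (s + 1) + B t \<noteq> A s + B (t + 1)"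
    proof
      assume "A (s + 1) + B t = A s + B (t + 1)"
      then have "A (s + 1) - A s = B (t + 1) - B t" by (simp add: algebra_simps)
      then show False using orth[of s t] A[of s] by simp
    qed
    moreover have "A s + B t \<noteq> A (s + 1) + B (t + 1)"
    proof
      assume "A s + B t = A (s + 1) + B (t + 1)"
      then have "B (t + 1) - B t = - (A (s + 1) - A s)" by (simp add: algebra_simps)
      then show False
        using orth[of s t] A[of s] by (metis inner_eq_zero_iff inner_minus_right neg_equal_0_iff_equal right_minus_eq)
    qed
    ultimately show "distinct [A s + B t, A (s + 1) + B t, A (s + 1) + B (t + 1), A s + B (t + 1)]"
      using A[of s] B[of t] by auto
    show "concircular {A s + B t, A (s + 1) + B t, A (s + 1) + B (t + 1), A s + B (t + 1)}"
      unfolding vertices by (rule rectangle_concircular) (use A B orth in auto)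
  qed
  show "isothermic_dd (\<lambda>s t. A s + B t)"
    unfolding isothermic_dd_def
  proof (intro exI conjI allI)
    fix s t
    show "(norm (B (t + 1) - B t))\<^sup>2 \<noteq> 0" using B by simp
    show "cr (A s + B t) (A (s + 1) + B t) (A (s + 1) + B (t + 1)) (A s + B (t + 1)) =
        - (norm (A (s + 1) - A s))\<^sup>2 / (norm (B (t + 1) - B t))\<^sup>2"
      unfolding vertices by (rule cr_rectangle) (use B orth in auto)
  qed
qed

text \<open>The coordinate \<open>p\<close> depends on the variable \<open>x (v p)\<close> only. So the net is a product of
  discrete curves, where the curve of the variable \<open>i\<close> lies in the subspace of
  the coordinates \<open>p\<close> with \<open>v p = i\<close>.\<close>

definition product_net ::
  "('n \<Rightarrow> nat) \<Rightarrow> ('n \<Rightarrow> int \<Rightarrow> real) \<Rightarrow> (nat \<Rightarrow> int) \<Rightarrow> real ^ 'n::finite" where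
  "product_net v G x = (\<chi> p. G p (x (v p)))"

lemma product_net_isothermic:
  fixes v :: "'n::finite \<Rightarrow> nat"
  assumes moves: "\<And>i m. i < k \<Longrightarrow> \<exists>p. v p = i \<and> G p (m + 1) \<noteq> G p m"
  shows "discrete_isothermic k (product_net v G)"
proof -
  have "circular_dd (\<lambda>s t. product_net v G (x(i := s, j := t)))
      \<and> isothermic_dd (\<lambda>s t. product_net v G (x(i := s, j := t)))"
    if "i < k" "j < k" "i \<noteq> j" for x i j
  proof -
    define A :: "int \<Rightarrow> real ^ 'n" where "A s = (\<chi> p. if v p = i then G p s else 0)" for s
    define B :: "int \<Rightarrow> real ^ 'n" where
      "B t = (\<chi> p. if v p = i then 0 else G p ((x(j := t)) (v p)))" for t
    have split: "product_net v G (x(i := s, j := t)) = A s + B t" for s t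
      using that by (auto simp: product_net_def A_def B_def vec_eq_iff)
    have "(A (s + 1) - A s) \<bullet> (B (t + 1) - B t) = 0" for s t
      by (auto simp: A_def B_def inner_vec_def intro!: sum.neutral)
    moreover have "A (s + 1) \<noteq> A s" for s
      using moves[OF \<open>i < k\<close>, of s] by (auto simp: A_def vec_eq_iff)
    moreover have "B (t + 1) \<noteq> B t" for t
      using moves[OF \<open>j < k\<close>, of t] \<open>i \<noteq> j\<close> by (auto simp: B_def vec_eq_iff)
    ultimately show ?thesis
      unfolding split using orthogonal_sum_net by blast
  qed
  then show ?thesis
    by (simp add: discrete_isothermic_def discrete_orthogonal_def)
qed

lemma product_net_adjacent_neq:
  assumes "v p = i" "G p (m + 1) \<noteq> G p m"
  shows "product_net v G (x(i := m)) \<noteq> product_net v G (x(i := m + 1))"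
  using assms by (auto simp: product_net_def vec_eq_iff intro!: exI[of _ p])

lemma product_net_periodic:
  assumes "\<And>p m. G p (m + l) = G p m"
  shows "product_net v G (x(i := x i + l)) = product_net v G x"
  using assms by (auto simp: product_net_def vec_eq_iff)

section \<open>Rotating discrete nets\<close>

definition rotating :: "'a \<Rightarrow> 'a \<Rightarrow> real \<Rightarrow> 'a::real_inner" where
  "rotating e e' t = cos t *\<^sub>R e + sin t *\<^sub>R e'"

text \<open>The velocity is written in the same form as the curve, so that it can be iterated.\<close>

lemma velocity_trigonometric:
  "velocity (\<lambda>t. cos t *\<^sub>R a + sin t *\<^sub>R b + c) = (\<lambda>t. cos t *\<^sub>R b + sin t *\<^sub>R (- a) + 0)"
  "(\<lambda>t. cos t *\<^sub>R a + sin t *\<^sub>R b + c) differentiable (at t)"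
proof -
  have D: "((\<lambda>t. cos t *\<^sub>R a + sin t *\<^sub>R b + c) has_vector_derivative
      (cos t *\<^sub>R b + sin t *\<^sub>R (- a) + 0)) (at t)" for t
    by (auto intro!: derivative_eq_intros simp: has_real_derivative_iff_has_vector_derivative[symmetric])
  show "velocity (\<lambda>t. cos t *\<^sub>R a + sin t *\<^sub>R b + c) = (\<lambda>t. cos t *\<^sub>R b + sin t *\<^sub>R (- a) + 0)"
    using vector_derivative_at[OF D] by blast
  show "(\<lambda>t. cos t *\<^sub>R a + sin t *\<^sub>R b + c) differentiable (at t)"
    using D[of t] by (rule differentiableI_vector)
qed

lemma smooth_curve_trigonometric: "smooth_curve (\<lambda>t. cos t *\<^sub>R a + sin t *\<^sub>R b + c)"
proof -
  have "\<exists>a' b' c'. (velocity ^^ m) (\<lambda>t. cos t *\<^sub>R a + sin t *\<^sub>R b + c)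
      = (\<lambda>t. cos t *\<^sub>R a' + sin t *\<^sub>R b' + c')" for m
  proof (induction m)
    case 0
    show ?case by (intro exI) simp
  next
    case (Suc m)
    then obtain a' b' c' where "(velocity ^^ m) (\<lambda>t. cos t *\<^sub>R a + sin t *\<^sub>R b + c)
      = (\<lambda>t. cos t *\<^sub>R a' + sin t *\<^sub>R b' + c')" by blast
    then have "(velocity ^^ Suc m) (\<lambda>t. cos t *\<^sub>R a + sin t *\<^sub>R b + c)
      = velocity (\<lambda>t. cos t *\<^sub>R a' + sin t *\<^sub>R b' + c')"
      by simp
    then show ?case unfolding velocity_trigonometric(1) by blast
  qed
  then show ?thesis
    unfolding smooth_curve_def using velocity_trigonometric(2) by metis
qed

lemma rotating_trigonometric:
  "(\<lambda>t. r *\<^sub>R rotating e e' t + w) = (\<lambda>t. cos t *\<^sub>R (r *\<^sub>R e) + sin t *\<^sub>R (r *\<^sub>R e') + w)"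
  by (auto simp: rotating_def scaleR_add_right mult.commute)

lemma smooth_rotating: "smooth_curve (\<lambda>t. r *\<^sub>R rotating e e' t + w)"
  unfolding rotating_trigonometric by (rule smooth_curve_trigonometric)

lemma velocity_rotating: "velocity (\<lambda>t. r *\<^sub>R rotating e e' t + w) t = r *\<^sub>R rotating e' (- e) t"
  unfolding rotating_trigonometric fun_cong[OF velocity_trigonometric(1)]
  by (simp add: rotating_def scaleR_diff_right mult.commute)

locale orthonormal_pair =
  fixes e e' :: "real ^ 'n::finite"
  assumes unit: "e \<bullet> e = 1" "e' \<bullet> e' = 1" and orth: "e \<bullet> e' = 0"
begin

lemma inner_rotating: "rotating e e' s \<bullet> rotating e e' t = cos (s - t)"
  using unit orth by (simp add: rotating_def inner_add inner_commute cos_diff)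

lemma inner_rotating_velocity: "rotating e e' t \<bullet> rotating e' (- e) t = 0"
  using unit orth by (simp add: rotating_def inner_add inner_diff inner_commute)

text \<open>The unit velocity of \<open>rotating e e'\<close> is \<open>rotating e' (- e)\<close>.\<close>

lemma inner_velocity: "rotating e' (- e) t \<bullet> rotating e' (- e) t = 1"
  using unit orth sin_cos_squared_add3[of t]
  by (simp add: rotating_def inner_diff inner_commute)

lemma regular_rotating:
  assumes "r \<noteq> 0"
  shows "regular_curve (\<lambda>t. r *\<^sub>R rotating e e' t + w)"
proof -
  have "rotating e' (- e) t \<noteq> 0" for t using inner_velocity[of t] by auto
  then show ?thesis using assms by (simp add: regular_curve_def velocity_rotating)
qed

text \<open>The law of cosines in the plane of rotation, with \<open>2 - 2 cos (t - s)\<close> the squared chord of the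
  unit circle, and Pythagoras for the part orthogonal to that plane.\<close>

lemma dist_rotating:
  assumes "p \<bullet> e = 0" "p \<bullet> e' = 0" "q \<bullet> e = 0" "q \<bullet> e' = 0"
  shows "(norm ((r *\<^sub>R rotating e e' s + p) - (r' *\<^sub>R rotating e e' t + q)))\<^sup>2 =
    (r - r')\<^sup>2 + (norm (p - q))\<^sup>2 + r * r' * (2 - 2 * cos (t - s))"
proof -
  have z: "p \<bullet> rotating e e' u = 0" "q \<bullet> rotating e e' u = 0" for u
    using assms by (simp_all add: rotating_def inner_add_right)
  then have z': "rotating e e' u \<bullet> p = 0" "rotating e e' u \<bullet> q = 0" for u
    by (simp_all add: inner_commute)
  have cos: "cos (s - t) = cos (t - s)"
    by (simp add: cos_diff)
  show ?thesis
    unfolding power2_norm_eq_inner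
    by (simp add: inner_add_left inner_add_right inner_diff_left inner_diff_right
        inner_rotating z z' cos inner_commute[of q p] algebra_simps power2_eq_square)
qed

end

lemma tendsto_chord: "((\<lambda>h::real. (2 - 2 * cos h) / h\<^sup>2) \<longlongrightarrow> 1) (at 0)"
proof -
  have eq: "(2 - 2 * cos h) / h\<^sup>2 = (sin (h / 2) / (h / 2))\<^sup>2" for h :: real
    using cos_double_sin[of "h / 2"] by (simp add: power_divide)
  have "((\<lambda>x::real. sin x / x) \<longlongrightarrow> 1) (at 0)"
    using DERIV_sin[of 0] by (simp add: has_field_derivative_iff)
  moreover have "filterlim (\<lambda>h::real. h / 2) (at 0) (at 0)"
    by (auto simp: filterlim_at eventually_at_filter intro!: tendsto_eq_intros)
  ultimately have "((\<lambda>h::real. sin (h / 2) / (h / 2)) \<longlongrightarrow> 1) (at 0)"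
    by (rule filterlim_compose)
  then have "((\<lambda>h::real. (sin (h / 2) / (h / 2))\<^sup>2) \<longlongrightarrow> 1\<^sup>2) (at 0)"
    by (rule tendsto_power)
  then show ?thesis by (simp add: eq)
qed

context orthonormal_pair
begin

text \<open>Let \<open>\<delta>\<close> be the squared chord of the unit circle for the angle \<open>h\<close>, and \<open>d\<close> the
  squared distance of corresponding points. The four points form an isosceles trapezoid with
  squared parallel sides \<open>r\<^sup>2 \<delta>\<close> and \<open>r'\<^sup>2 \<delta>\<close>, squared legs \<open>d\<close> and squared diagonals
  \<open>d + r r' \<delta>\<close>. So its cross ratio is exactly \<open>- r r' \<delta> / d\<close>, and \<open>\<delta> / h\<^sup>2\<close>
  tends to \<open>1\<close>.\<close>

lemma infinitesimal_cr_rotating: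
  assumes pq: "p \<bullet> e = 0" "p \<bullet> e' = 0" "q \<bullet> e = 0" "q \<bullet> e' = 0"
    and nz: "(r - r')\<^sup>2 + (norm (p - q))\<^sup>2 \<noteq> 0"
  shows "has_infinitesimal_cr (\<lambda>t. r *\<^sub>R rotating e e' t + p) (\<lambda>t. r' *\<^sub>R rotating e e' t + q) t
    (- (r * r') / ((r - r')\<^sup>2 + (norm (p - q))\<^sup>2))"
proof -
  define d where "d = (r - r')\<^sup>2 + (norm (p - q))\<^sup>2"
  define y where "y s = r *\<^sub>R rotating e e' s + p" for s
  define z where "z s = r' *\<^sub>R rotating e e' s + q" for s
  have "d \<noteq> 0" using nz by (simp add: d_def)
  have "cr (y t) (y (t + h)) (z (t + h)) (z t) / h\<^sup>2
      = (- (r * r') / d) * ((2 - 2 * cos h) / h\<^sup>2)" for h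
  proof -
    define \<delta> where "\<delta> = 2 - 2 * cos h"
    have dists: "(norm (y t - y (t + h)))\<^sup>2 = r\<^sup>2 * \<delta>" "(norm (z (t + h) - z t))\<^sup>2 = r'\<^sup>2 * \<delta>"
      "(norm (y t - z t))\<^sup>2 = d" "(norm (y (t + h) - z (t + h)))\<^sup>2 = d"
      "(norm (y t - z (t + h)))\<^sup>2 = d + r * r' * \<delta>" "(norm (y (t + h) - z t))\<^sup>2 = d + r * r' * \<delta>"
      unfolding y_def z_def using pq
      by (simp_all only: dist_rotating) (simp_all add: \<delta>_def d_def power2_eq_square)
    have "cr (y t) (y (t + h)) (z (t + h)) (z t) =
        (r\<^sup>2 * \<delta> * (r'\<^sup>2 * \<delta>) + d * d - (d + r * r' * \<delta>) * (d + r * r' * \<delta>)) / (2 * d * d)"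
      unfolding cr_eq_norms dists ..
    also have "\<dots> = (- (r * r') / d) * \<delta>"
      using \<open>d \<noteq> 0\<close> by (simp add: field_simps power2_eq_square)
    finally show ?thesis by (simp add: \<delta>_def)
  qed
  then show ?thesis
    unfolding has_infinitesimal_cr_def y_def[symmetric] z_def[symmetric] d_def[symmetric]
    using tendsto_mult[OF tendsto_const tendsto_chord, of "- (r * r') / d"] by simp
qed

text \<open>The segment that joins the two points is orthogonal to their common tangent direction, so the
  circle with this segment as diameter, in the plane that contains this direction, is tangent to
  both curves.\<close>

lemma circle_tangent_to_rotating:
  assumes pq: "p \<bullet> e = 0" "p \<bullet> e' = 0" "q \<bullet> e = 0" "q \<bullet> e' = 0"
    and neq: "r *\<^sub>R rotating e e' t + p \<noteq> r' *\<^sub>R rotating e e' t + q"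
  shows "\<exists>C. moebius_circle C \<and>
    tangent_to_circle C (r *\<^sub>R rotating e e' t + p) (r *\<^sub>R rotating e' (- e) t) \<and>
    tangent_to_circle C (r' *\<^sub>R rotating e e' t + q) (r' *\<^sub>R rotating e' (- e) t)"
proof -
  define y where "y = r *\<^sub>R rotating e e' t + p"
  define z where "z = r' *\<^sub>R rotating e e' t + q"
  define d where "d = z - y"
  define u where "u = rotating e' (- e) t"
  define P where "P = (+) y ` span {d, u}"
  define c where "c = y + (1/2) *\<^sub>R d"
  define C where "C = P \<inter> sphere c (norm d / 2)"
  have "d \<noteq> 0" using neq by (simp add: d_def y_def z_def)
  moreover have "u \<noteq> 0" using inner_velocity[of t] by (auto simp: u_def)
  moreover have du: "d \<bullet> u = 0"
  proof -
    have "p \<bullet> u = 0" "q \<bullet> u = 0"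
      using pq by (simp_all add: u_def rotating_def inner_add_right inner_diff_right)
    then show ?thesis
      using inner_rotating_velocity[of t]
      by (simp add: d_def y_def z_def u_def inner_diff_left inner_add_left)
  qed
  ultimately have round: "round_circle P c (norm d / 2) C"
    unfolding P_def c_def C_def by (rule round_circle_with_diameter)
  have plane: "y \<in> P" "z \<in> P" "y + s *\<^sub>R u \<in> P" "z + s *\<^sub>R u \<in> P" for s
    using plane_point[of y 0 d 0 u] plane_point[of y 1 d 0 u] plane_point[of y 0 d s u]
      plane_point[of y 1 d s u]
    by (simp_all add: P_def d_def algebra_simps)
  have radii: "y - c = (-1/2) *\<^sub>R d" "z - c = (1/2) *\<^sub>R d"
    by (simp_all add: c_def d_def vec_eq_iff field_simps)
  then have "y \<in> C" "z \<in> C"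
    using plane by (simp_all add: C_def dist_norm norm_minus_commute[of c])
  then have "tangent_to_circle C y (s *\<^sub>R u)" "tangent_to_circle C z (s *\<^sub>R u)" for s
    unfolding tangent_to_circle_def using round plane radii du
    by (auto simp: inner_commute intro!: exI[of _ P] exI[of _ c])
  moreover have "moebius_circle C"
    unfolding moebius_circle_def using round by blast
  ultimately show ?thesis unfolding y_def z_def u_def by blast
qed

lemma rotating_net:
  fixes r :: "int \<Rightarrow> real" and w :: "int \<Rightarrow> real ^ 'n"
  assumes pos: "\<And>m. r m > 0"
    and w: "\<And>m. w m \<bullet> e = 0" "\<And>m. w m \<bullet> e' = 0"
    and neq: "\<And>m. r (m + 1) \<noteq> r m \<or> w (m + 1) \<noteq> w m"
  shows "circular_sd (\<lambda>t m. r m *\<^sub>R rotating e e' t + w m)"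
    and "isothermic_sd (\<lambda>t m. r m *\<^sub>R rotating e e' t + w m)"
proof -
  define d where "d m = (r m - r (m + 1))\<^sup>2 + (norm (w m - w (m + 1)))\<^sup>2" for m
  have d: "d m \<noteq> 0" for m
    using neq[of m] by (auto simp: d_def add_nonneg_eq_0_iff)
  have "(norm ((r m *\<^sub>R rotating e e' t + w m) - (r (m + 1) *\<^sub>R rotating e e' t + w (m + 1))))\<^sup>2
      = d m" for t m
    by (simp add: dist_rotating w d_def)
  with d have distinct:
    "r m *\<^sub>R rotating e e' t + w m \<noteq> r (m + 1) *\<^sub>R rotating e e' t + w (m + 1)" for t m
    by (metis norm_zero power_zero_numeral right_minus_eq)
  then show "circular_sd (\<lambda>t m. r m *\<^sub>R rotating e e' t + w m)"
    unfolding circular_sd_def common_circle_congruence_def velocity_rotating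
    by (intro allI conjI circle_tangent_to_rotating w)
  show "isothermic_sd (\<lambda>t m. r m *\<^sub>R rotating e e' t + w m)"
    unfolding isothermic_sd_def
  proof (intro exI conjI allI)
    fix t m
    show "d m / (r m * r (m + 1)) \<noteq> 0"
      using d[of m] pos[of m] pos[of "m + 1"] by simp
    have "- (r m * r (m + 1)) / d m = -1 / (d m / (r m * r (m + 1)))"
      by simp
    then show "has_infinitesimal_cr (\<lambda>t. r m *\<^sub>R rotating e e' t + w m)
        (\<lambda>t. r (m + 1) *\<^sub>R rotating e e' t + w (m + 1)) t (-1 / (d m / (r m * r (m + 1))))"
      using infinitesimal_cr_rotating[OF w w, of "r m" "r (m + 1)"] d[of m]
      by (metis d_def infinitesimal_cr_rotating w)
  qed
qed

end

section \<open>Fullness\<close>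

text \<open>A proper hyperplane is a level set of a nonzero linear form.\<close>

lemma fullI:
  fixes S :: "(real ^ 'n::finite) set"
  assumes "\<And>a b. (\<And>y. y \<in> S \<Longrightarrow> a \<bullet> y = b) \<Longrightarrow> a = 0"
  shows "full S"
  unfolding full_def
proof
  assume "\<exists>A. affine A \<and> aff_dim A = int CARD('n) - 1 \<and> S \<subseteq> A"
  then obtain A where A: "affine A" "aff_dim A = int CARD('n) - 1" "S \<subseteq> A" by blast
  then obtain a b where "a \<noteq> 0" "affine hull A = {y. a \<bullet> y = b}"
    using aff_dim_eq_hyperplane[of A] by auto
  moreover have "affine hull A = A" using A(1) by (simp add: affine_hull_eq)
  ultimately have "a \<noteq> 0" "\<And>y. y \<in> S \<Longrightarrow> a \<bullet> y = b" using A(3) by auto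
  then show False using assms[of a b] by blast
qed

section \<open>The two tori\<close>

lemma fun_upd_int_lattice: "x \<in> int_lattice k \<Longrightarrow> i < k \<Longrightarrow> x(i := m) \<in> int_lattice k"
  by (auto simp: int_lattice_def PiE_def extensional_def)

definition origin :: "nat \<Rightarrow> nat \<Rightarrow> int" where
  "origin k = (\<lambda>i\<in>{..<k}. 0)"

lemma origin_in_lattice: "origin k \<in> int_lattice k"
  by (simp add: origin_def int_lattice_def)

lemma origin_apply: "i < k \<Longrightarrow> origin k i = 0"
  by (simp add: origin_def)

lemma mod_neq_mod_add_1: "(m + 1) mod l \<noteq> m mod l" if "l \<ge> 2" for l m :: int
proof
  assume "(m + 1) mod l = m mod l"
  then have "l dvd 1" by (simp add: mod_eq_dvd_iff)
  then show False using that by (simp add: zdvd_not_zless)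
qed

lemma coordinate_numbering:
  obtains \<iota> :: "'n::finite \<Rightarrow> nat" where "\<And>p. \<iota> p < CARD('n)"
    and "\<And>i. i < CARD('n) \<Longrightarrow> \<exists>p. \<iota> p = i" and "\<And>p q. \<iota> p = \<iota> q \<longleftrightarrow> p = q"
proof -
  obtain \<iota> :: "'n \<Rightarrow> nat" where \<iota>: "bij_betw \<iota> UNIV {..<CARD('n)}"
    using ex_bij_betw_finite_nat[OF finite, of "UNIV :: 'n set"] by (auto simp: atLeast0LessThan)
  show thesis
  proof (rule that)
    show "\<iota> p < CARD('n)" for p using \<iota> by (auto simp: bij_betw_def)
    show "\<exists>p. \<iota> p = i" if "i < CARD('n)" for i
      using \<iota> that by (metis UNIV_I bij_betw_def imageE lessThan_iff)
    show "\<iota> p = \<iota> q \<longleftrightarrow> p = q" for p q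
      using \<iota> by (auto simp: bij_betw_def inj_on_def)
  qed
qed

text \<open>For \<open>i < k\<close>, the coordinate number \<open>i\<close> belongs to the variable \<open>i\<close> and takes the
  values \<open>0, ..., n\<close> cyclically. The remaining coordinates belong to the variable \<open>0\<close>; each of
  them is nonzero at a single residue of that variable modulo \<open>n + 1\<close>, a different one for each coordinate, which
  makes the net full.\<close>

lemma full_isothermic_discrete_torus:
  assumes k: "2 \<le> k" "k \<le> CARD('n::finite)"
  shows "\<exists>f :: (nat \<Rightarrow> int) \<Rightarrow> real ^ 'n.
    discrete_torus k f \<and> discrete_isothermic k f \<and> full (f ` int_lattice k)"
proof -
  obtain \<iota> :: "'n \<Rightarrow> nat" where \<iota>_less: "\<And>p. \<iota> p < CARD('n)"
    and \<iota>_surj: "\<And>i. i < CARD('n) \<Longrightarrow> \<exists>p. \<iota> p = i" and \<iota>_inj: "\<And>p q. \<iota> p = \<iota> q \<longleftrightarrow> p = q"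
    using coordinate_numbering by metis
  \<comment> \<open>A common period that is at least 3 and has residues for all coordinate numbers below \<open>n\<close>.\<close>
  define L where "L = int CARD('n) + 1"
  have L: "L \<ge> 3" using k by (simp add: L_def)
  define v where "v p = (if \<iota> p < k then \<iota> p else 0)" for p
  define G :: "'n \<Rightarrow> int \<Rightarrow> real" where
    "G p m = (if \<iota> p < k then of_int (m mod L) else of_bool (m mod L = int (\<iota> p)))" for p m
  define f where "f = product_net v G"
  have "discrete_torus k f"
    unfolding discrete_torus_def f_def
    using L by (auto intro!: exI[of _ L] product_net_periodic simp: G_def)
  moreover have "discrete_isothermic k f"
    unfolding f_def
  proof (rule product_net_isothermic)
    fix i m assume "i < k"
    with k obtain p where "\<iota> p = i" using \<iota>_surj[of i] by auto
    then show "\<exists>p. v p = i \<and> G p (m + 1) \<noteq> G p m"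
      using \<open>i < k\<close> L mod_neq_mod_add_1[of L m] by (auto simp: v_def G_def intro!: exI[of _ p])
  qed
  moreover have "full (f ` int_lattice k)"
  proof (rule fullI)
    fix a b assume ab: "\<And>y. y \<in> f ` int_lattice k \<Longrightarrow> a \<bullet> y = b"
    have diff: "a \<bullet> (f ((origin k)(i := m)) - f (origin k)) = 0" if "i < k" for i m
      using ab[of "f ((origin k)(i := m))"] ab[of "f (origin k)"] that
      by (simp add: inner_diff_right origin_in_lattice fun_upd_int_lattice)
    have coord: "a $ p = 0" if p: "\<iota> p < k" for p
    proof -
      \<comment> \<open>The coordinates number \<open>k\<close> and above still vanish at \<open>1\<close>, since \<open>k \<ge> 2\<close>.\<close>
      have "f ((origin k)(\<iota> p := 1)) - f (origin k) = axis p 1"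
        using p k L \<iota>_inj
        by (auto simp: f_def product_net_def vec_eq_iff axis_def v_def G_def origin_apply)
      then show ?thesis using diff[OF p, of 1] by (simp add: inner_axis)
    qed
    obtain q where q: "\<iota> q = 0" using \<iota>_surj[of 0] k by auto
    have q_eq: "\<iota> p = 0 \<longleftrightarrow> p = q" for p using \<iota>_inj q by metis
    have q_less: "\<iota> q < k" using q k by simp
    have "a $ p = 0" for p
    proof (cases "\<iota> p < k")
      case False
      have "f ((origin k)(0 := int (\<iota> p))) - f (origin k) =
          axis q (real (\<iota> p)) + axis p 1"
        using False k L \<iota>_inj q_less \<iota>_less[of p]
        by (auto simp: q_eq f_def product_net_def vec_eq_iff axis_def v_def G_def origin_apply L_def)
      then have "a \<bullet> (axis q (real (\<iota> p)) + axis p 1) = 0" using diff[of 0 "int (\<iota> p)"] k by simp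
      then show ?thesis using coord[of q] k q by (simp add: inner_axis inner_add_right)
    qed (use coord in simp)
    then show "a = 0" by (simp add: vec_eq_iff)
  qed
  ultimately show ?thesis by blast
qed

text \<open>The coordinates number \<open>0\<close> and \<open>1\<close> span the plane of rotation, and the radius
  depends on the variable \<open>0\<close>. The coordinates number \<open>2, ..., k - 1\<close> belong to the variables
  \<open>1, ..., k - 2\<close>, and the remaining ones again to the variable \<open>0\<close>.\<close>

lemma full_isothermic_semi_discrete_torus:
  assumes k: "2 \<le> k" "k \<le> CARD('n::finite)"
  shows "\<exists>f :: real \<Rightarrow> (nat \<Rightarrow> int) \<Rightarrow> real ^ 'n.
    semi_discrete_torus k f \<and> semi_discrete_isothermic k f \<and>
    full {f t x | t x. x \<in> int_lattice (k - 1)}"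
proof -
  obtain \<iota> :: "'n \<Rightarrow> nat" where \<iota>_less: "\<And>p. \<iota> p < CARD('n)"
    and \<iota>_surj: "\<And>i. i < CARD('n) \<Longrightarrow> \<exists>p. \<iota> p = i" and \<iota>_inj: "\<And>p q. \<iota> p = \<iota> q \<longleftrightarrow> p = q"
    using coordinate_numbering by metis
  obtain o1 o2 where o: "\<iota> o1 = 0" "\<iota> o2 = 1" using \<iota>_surj[of 0] \<iota>_surj[of 1] k by auto
  have o_eq: "\<iota> p = 0 \<longleftrightarrow> p = o1" "\<iota> p = Suc 0 \<longleftrightarrow> p = o2" for p
    using \<iota>_inj o by (metis, metis One_nat_def)
  have "o1 \<noteq> o2" using o by auto
  define e e' :: "real ^ 'n" where "e = axis o1 1" and "e' = axis o2 1"
  interpret orthonormal_pair e e'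
    using \<open>o1 \<noteq> o2\<close> by unfold_locales (auto simp: e_def e'_def inner_axis_axis)
  \<comment> \<open>A common period that is at least 3 and has residues for all coordinate numbers below \<open>n\<close>.\<close>
  define L where "L = int CARD('n) + 1"
  have L: "L \<ge> 3" using k by (simp add: L_def)
  define v where "v p = (if \<iota> p < k then \<iota> p - 1 else 0)" for p
  define r :: "int \<Rightarrow> real" where "r m = 1 + of_int (m mod L)" for m
  define H :: "'n \<Rightarrow> int \<Rightarrow> real" where
    "H p m = (if \<iota> p < 2 then 0 else if \<iota> p < k then of_int (m mod L)
      else of_bool (m mod L = int (\<iota> p)))" for p m
  define f where "f t x = r (x 0) *\<^sub>R rotating e e' t + product_net v H x" for t x
  have r_pos: "r m > 0" for m using L by (simp add: r_def add_pos_nonneg)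
  have periodic: "r (m + L) = r m" "H p (m + L) = H p m" for p m
    by (simp_all add: r_def H_def)
  have H_perp: "product_net v H x \<bullet> e = 0" "product_net v H x \<bullet> e' = 0" for x
    using o by (simp_all add: e_def e'_def inner_axis product_net_def H_def)
  \<comment> \<open>For fixed \<open>t\<close>, the rotated net is a product net whose curve of the variable 0 contains the
    whole radial direction.\<close>
  define G :: "real \<Rightarrow> 'n \<Rightarrow> int \<Rightarrow> real" where
    "G t p m = (if p = o1 then r m * cos t else if p = o2 then r m * sin t else H p m)" for t p m
  have product: "f t = product_net v (G t)" for t
    using o \<open>o1 \<noteq> o2\<close> k
    by (auto simp: fun_eq_iff f_def product_net_def vec_eq_iff G_def v_def rotating_def
        e_def e'_def axis_def H_def)
  have moves: "\<exists>p. v p = i \<and> G t p (m + 1) \<noteq> G t p m" if i: "i < k - 1" for i t m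
  proof (cases "i = 0")
    case True
    have r: "r (m + 1) \<noteq> r m" using L mod_neq_mod_add_1[of L m] by (simp add: r_def)
    show ?thesis
    proof (cases "cos t = 0")
      case True
      then have "sin t \<noteq> 0" using sin_cos_squared_add[of t] by auto
      with r \<open>i = 0\<close> \<open>o1 \<noteq> o2\<close> o show ?thesis by (intro exI[of _ o2]) (auto simp: v_def G_def)
    next
      case False
      with r \<open>i = 0\<close> o show ?thesis by (intro exI[of _ o1]) (auto simp: v_def G_def)
    qed
  next
    case False
    obtain p where p: "\<iota> p = Suc i" using \<iota>_surj[of "Suc i"] i k by fastforce
    then have "p \<noteq> o1" "p \<noteq> o2" using o False by auto
    then show ?thesis using p i False L mod_neq_mod_add_1[of L m]
      by (intro exI[of _ p]) (auto simp: v_def G_def H_def)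
  qed
  have net: "semi_discrete_net k f"
    unfolding semi_discrete_net_def f_def
    using r_pos by (auto intro!: smooth_rotating regular_rotating simp: less_imp_neq[symmetric])
  have "semi_discrete_torus k f"
    unfolding semi_discrete_torus_def
  proof (intro conjI allI impI net)
    show "\<exists>p>0. \<forall>t. \<forall>x \<in> int_lattice (k - 1). f (t + p) x = f t x"
      by (rule exI[of _ "2 * pi"]) (simp add: f_def rotating_def)
    show "\<exists>l\<ge>3. \<forall>t. \<forall>x \<in> int_lattice (k - 1). f t (x(i := x i + l)) = f t x" for i
      using L unfolding product
      by (intro exI[of _ L]) (simp add: product_net_periodic G_def periodic)
  qed
  moreover have iso: "discrete_isothermic (k - 1) (f t)" for t
    unfolding product using moves by (rule product_net_isothermic)
  have "circular_sd (\<lambda>t m. f t (x(j := m))) \<and> isothermic_sd (\<lambda>t m. f t (x(j := m)))"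
    if j: "j < k - 1" for x j
  proof -
    have "r ((x(j := m + 1)) 0) \<noteq> r ((x(j := m)) 0) \<or>
        product_net v H (x(j := m + 1)) \<noteq> product_net v H (x(j := m))" for m
    proof -
      \<comment> \<open>Adjacent circles that agree in radius and axial part would coincide, also at angle \<open>0\<close>.\<close>
      obtain p where p: "v p = j" "G 0 p (m + 1) \<noteq> G 0 p m" using moves[OF j] by blast
      then have "f 0 (x(j := m)) \<noteq> f 0 (x(j := m + 1))"
        unfolding product by (rule product_net_adjacent_neq)
      then show ?thesis by (auto simp: f_def)
    qed
    then show ?thesis
      unfolding f_def
      using rotating_net[of "\<lambda>m. r ((x(j := m)) 0)" "\<lambda>m. product_net v H (x(j := m))"]
        r_pos H_perp by blast
  qed
  with net iso have "semi_discrete_isothermic k f"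
    by (simp add: semi_discrete_isothermic_def semi_discrete_orthogonal_def
        discrete_isothermic_def)
  moreover have "full {f t x | t x. x \<in> int_lattice (k - 1)}" (is "full ?S")
  proof (rule fullI)
    fix a b assume ab: "\<And>y. y \<in> ?S \<Longrightarrow> a \<bullet> y = b"
    let ?O = "origin (k - 1)"
    have k1: "0 < k - 1" using k by simp
    have diff: "a \<bullet> (f t x - f t' x') = 0"
      if "x \<in> int_lattice (k - 1)" "x' \<in> int_lattice (k - 1)" for t t' x x'
    proof -
      have "a \<bullet> f t x = b" "a \<bullet> f t' x' = b" using that by (blast intro: ab)+
      then show ?thesis by (simp add: inner_diff_right)
    qed
    note lattice = origin_in_lattice fun_upd_int_lattice[OF origin_in_lattice]
    \<comment> \<open>Opposite points of one of the circles, of radius 1, give the plane of rotation.\<close>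
    have "f 0 ?O - f pi ?O = 2 *\<^sub>R e" "f (pi / 2) ?O - f (- pi / 2) ?O = 2 *\<^sub>R e'"
      using k1 by (simp_all add: f_def rotating_def r_def origin_apply flip: scaleR_2)
    then have "a \<bullet> (2 *\<^sub>R e) = 0" "a \<bullet> (2 *\<^sub>R e') = 0"
      using diff[of ?O ?O] by (metis lattice(1))+
    then have circle: "a $ o1 = 0" "a $ o2 = 0" by (simp_all add: e_def e'_def inner_axis)
    have "a $ p = 0" for p
    proof -
      consider "\<iota> p < 2" | "2 \<le> \<iota> p" "\<iota> p < k" | "2 \<le> \<iota> p" "k \<le> \<iota> p" by linarith
      then show ?thesis
      proof cases
        case 1
        then have "p = o1 \<or> p = o2" using o_eq[of p] by auto
        then show ?thesis using circle by auto
      next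
        case 2
        have pred: "\<iota> i - Suc 0 = \<iota> p - Suc 0 \<longleftrightarrow> i = p" if "\<not> \<iota> i < 2" for i
        proof -
          have "\<iota> i - Suc 0 = \<iota> p - Suc 0 \<longleftrightarrow> \<iota> i = \<iota> p" using 2 that by linarith
          then show ?thesis by (simp add: \<iota>_inj)
        qed
        have "f 0 (?O(\<iota> p - 1 := 1)) - f 0 ?O = axis p 1"
          using 2 k1 L pred
          by (auto simp: f_def product_net_def vec_eq_iff axis_def v_def H_def r_def origin_apply)
        then show ?thesis using diff[of "?O(\<iota> p - 1 := 1)" ?O 0 0] lattice 2
          by (simp add: inner_axis)
      next
        case 3
        have "f 0 (?O(0 := int (\<iota> p))) - f 0 ?O = real (\<iota> p) *\<^sub>R e + axis p 1"
          using 3 k1 L \<iota>_inj \<iota>_less[of p]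
          by (auto simp: f_def product_net_def vec_eq_iff axis_def v_def H_def r_def origin_apply
              rotating_def e_def e'_def L_def)
        then have "a \<bullet> (real (\<iota> p) *\<^sub>R e + axis p 1) = 0"
          using diff[of "?O(0 := int (\<iota> p))" ?O 0 0] lattice k1 by simp
        then show ?thesis using circle by (simp add: e_def inner_axis inner_add_right)
      qed
    qed
    then show "a = 0" by (simp add: vec_eq_iff)
  qed
  ultimately show ?thesis by blast
qed

theorem theorem1p1:
  fixes k n :: nat
  assumes "2 \<le> k" and "k \<le> n" and "CARD('n::finite) = n"
  shows "(\<exists>f :: (nat \<Rightarrow> int) \<Rightarrow> real ^ 'n.
            discrete_torus k f \<and> discrete_isothermic k f \<and> full (f ` int_lattice k))
       \<and> (\<exists>f :: real \<Rightarrow> (nat \<Rightarrow> int) \<Rightarrow> real ^ 'n.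
            semi_discrete_torus k f \<and> semi_discrete_isothermic k f \<and>
            full {f t x | t x. x \<in> int_lattice (k - 1)})"
  using assms full_isothermic_discrete_torus full_isothermic_semi_discrete_torus by blast

end
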